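(* Let $f:\mathbb{Z}_n\to\mathbb{Z}_n$ be a permutation of order $m$, let $r>1$, and let $i_1,\dots,i_r\in\mathbb{Z}_m$ be nonzero and pairwise different. Put $\mathcal{I}=\{0,i_1,\dots,i_r\}\subseteq\mathbb{Z}_m$. Then the parity-check matrix $$H=\begin{pmatrix}1&1&\cdots&1\\ 1&f^{i_1}&\cdots&f^{i_r}\end{pmatrix}$$ has no $4$-cycle if and only if $f^{t}$ is a derangement for every $t\in\mathcal{I}_\Delta$.
   Context: $\mathbb{Z}_n$ denotes the integers modulo $n$. A permutation $R$ of $\mathbb{Z}_n$ is identified with the $n\times n$ $0/1$ permutation matrix having entry $1$ at position $(a,c)$ iff $a=R(c)$; $1$ denotes the identity permutation (matrix). An array of permutations denotes the corresponding block matrix, here of size $2n\times(r+1)n$. Exponents of $f$ are taken modulo $m$, the order of $f$ in the symmetric group on $\mathbb{Z}_n$. A derangement is a permutation without fixed points. $\mathcal{I}_\Delta=\{a-b : a,b\in\mathcal{I},\ a\neq b\}\subseteq\mathbb{Z}_m$. Cycles: a $2k$-cycle in $H$ ($k>1$) is a closed sequence of positions $(x_0,y_0),(x_1,y_0),(x_1,y_1),\dots,(x_{k-1},y_{k-1}),(x_0,y_{k-1}),(x_0,y_0)$ of $H$, obtained by alternately changing only the row or only the column, such that all these entries of $H$ equal $1$ and the $2k$ positions (other than the repeated first/last one) are pairwise distinct. *)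

theory Defs
  imports "Jordan_Normal_Form.Matrix" "HOL-Algebra.Multiplicative_Group" "HOL-Combinatorics.Permutations"
begin

(* Z_n is represented by the residues {..<n} :: nat set; a permutation of Z_n is a function p with
   "p permutes {..<n}" (hence p is the identity off {..<n}). *)

definition symmetric_group :: "'a set \<Rightarrow> ('a \<Rightarrow> 'a) monoid" where
  "symmetric_group S = \<lparr>carrier = {p. p permutes S}, monoid.mult = (\<circ>), one = id\<rparr>"

definition derangement :: "nat \<Rightarrow> (nat \<Rightarrow> nat) \<Rightarrow> bool" where
  "derangement n p \<longleftrightarrow> p permutes {..<n} \<and> (\<forall>c<n. p c \<noteq> c)"

definition perm_matrix :: "nat \<Rightarrow> (nat \<Rightarrow> nat) \<Rightarrow> 'a::zero_neq_one mat" where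
  "perm_matrix n R = mat n n (\<lambda>(a, c). if a = R c then 1 else 0)"

(* The b x d array P of permutations of Z_n, read as a block matrix. *)
definition perm_block_matrix ::
    "nat \<Rightarrow> nat \<Rightarrow> nat \<Rightarrow> (nat \<Rightarrow> nat \<Rightarrow> nat \<Rightarrow> nat) \<Rightarrow> 'a::zero_neq_one mat" where
  "perm_block_matrix n b d P =
     mat (b * n) (d * n)
       (\<lambda>(x, y). perm_matrix n (P (x div n) (y div n)) $$ (x mod n, y mod n))"

(* Z_m is represented by {0..<m} :: int set. The block columns are numbered 0,...,r, and the
   exponents i 1,...,i r belong to the block columns 1,...,r. *)
definition parity_check_matrix ::
    "nat \<Rightarrow> nat \<Rightarrow> (nat \<Rightarrow> nat) \<Rightarrow> (nat \<Rightarrow> int) \<Rightarrow> 'a::zero_neq_one mat" where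
  "parity_check_matrix n r f i =
     perm_block_matrix n 2 (r + 1)
       (\<lambda>u l. if u = 0 \<or> l = 0 then id else f ^^ nat (i l))"

definition difference_set :: "nat \<Rightarrow> int set \<Rightarrow> int set" where
  "difference_set m I = {(a - b) mod int m | a b. a \<in> I \<and> b \<in> I \<and> a \<noteq> b}"

(* For l = 0,1,...,2k-1 this runs through
   (x_0,y_0), (x_1,y_0), (x_1,y_1), ..., (x_(k-1),y_(k-1)), (x_0,y_(k-1)). *)
definition cycle_position ::
    "nat \<Rightarrow> (nat \<Rightarrow> nat) \<Rightarrow> (nat \<Rightarrow> nat) \<Rightarrow> nat \<Rightarrow> nat \<times> nat" where
  "cycle_position k x y l = (x (((l + 1) div 2) mod k), y (l div 2))"

definition has_cycle :: "'a::zero_neq_one mat \<Rightarrow> nat \<Rightarrow> bool" where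
  "has_cycle H len \<longleftrightarrow>
     (\<exists>k x y. len = 2 * k \<and> k > 1 \<and>
        (\<forall>l<2 * k. cycle_position k x y l \<in> {..<dim_row H} \<times> {..<dim_col H} \<and>
                   H $$ cycle_position k x y l = 1) \<and>
        inj_on (cycle_position k x y) {..<2 * k})"

end

theory Submission
  imports Defs "HOL-Combinatorics.Cycles"
begin

text \<open>
  Two rows of the same block row never share a column, so a 4-cycle consists of one row in each
  block row. The identity blocks force its two columns to have the same offset \<open>c\<close>, and the 4-cycle
  is then the same thing as a coincidence \<open>(f ^^ a) c = (f ^^ b) c\<close> for two exponents \<open>a \<noteq> b\<close> in
  \<open>I\<close>, that is, a fixed point \<open>c\<close> of \<open>f ^^ t\<close> with \<open>t = (a - b) mod m\<close>.
\<close>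

lemma group_symmetric_group: "group (symmetric_group S)"
proof (rule groupI)
  fix p assume "p \<in> carrier (symmetric_group S)"
  then have p: "p permutes S" by (simp add: symmetric_group_def)
  show "\<exists>q\<in>carrier (symmetric_group S). q \<otimes>\<^bsub>symmetric_group S\<^esub> p = \<one>\<^bsub>symmetric_group S\<^esub>"
    using permutes_inv[OF p] permutes_inv_o(2)[OF p]
    by (auto simp: symmetric_group_def)
qed (auto simp: symmetric_group_def permutes_compose o_assoc)

lemma symmetric_group_pow: "p [^]\<^bsub>symmetric_group S\<^esub> (k::nat) = p ^^ k"
proof (induction k)
  case (Suc k)
  \<comment> \<open>The group power gains its new factor on the right, whereas \<open>funpow\<close>
    unfolds on the left; \<open>funpow_Suc_right\<close> aligns the two.\<close>
  then show ?case by (simp only: nat_pow_Suc funpow_Suc_right) (simp add: symmetric_group_def)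
qed (simp add: symmetric_group_def id_def)

text \<open>Carries the group-theoretic order over to iteration, so that exponents of
  \<open>p\<close> can be reduced modulo it.\<close>

lemma funpow_ord_symmetric_group:
  assumes "p permutes S"
  shows "p ^^ group.ord (symmetric_group S) p = id"
proof -
  interpret group "symmetric_group S" by (rule group_symmetric_group)
  have "p [^]\<^bsub>symmetric_group S\<^esub> ord p = \<one>\<^bsub>symmetric_group S\<^esub>"
    using assms by (intro pow_ord_eq_1) (simp add: symmetric_group_def)
  then show ?thesis
    by (simp add: symmetric_group_pow) (simp add: symmetric_group_def)
qed

text \<open>With \<open>t\<close> the reduced difference, \<open>b + t\<close> is congruent to
  \<open>a\<close> modulo \<open>m\<close>, so \<open>f ^^ a\<close> is \<open>f ^^ b\<close> after
  \<open>f ^^ t\<close>; the injective \<open>f ^^ b\<close> then cancels.\<close>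

lemma funpow_eq_iff_fixpoint:
  assumes "inj f" "f ^^ m = id" "m > 0"
  shows "(f ^^ a) c = (f ^^ b) c \<longleftrightarrow> (f ^^ nat ((int a - int b) mod int m)) c = c"
proof -
  define t where "t = nat ((int a - int b) mod int m)"
  \<comment> \<open>The difference \<open>a - b\<close> may be negative, so the congruence is
    checked over the integers first.\<close>
  have "int ((t + b) mod m) = int (a mod m)"
    using \<open>m > 0\<close> by (simp add: t_def zmod_int mod_add_left_eq)
  then have eq: "(t + b) mod m = a mod m" by simp
  have "(f ^^ a) c = (f ^^ (b + t)) c"
    using funpow_mod_eq[of m f c a] funpow_mod_eq[of m f c "t + b"] assms(2) eq
    by (simp add: add.commute)
  also have "\<dots> = (f ^^ b) ((f ^^ t) c)"
    by (simp add: funpow_add)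
  finally show ?thesis
    using inj_fn[OF assms(1), of b] by (auto simp: t_def inj_eq)
qed

text \<open>For \<open>k = 2\<close> the four positions are the corners of a rectangle, and they are
  pairwise distinct exactly when its two rows and its two columns are.\<close>

lemma has_cycle_4_iff:
  "has_cycle H 4 \<longleftrightarrow>
     (\<exists>a<dim_row H. \<exists>b<dim_row H. \<exists>c<dim_col H. \<exists>d<dim_col H. a \<noteq> b \<and> c \<noteq> d \<and>
        H $$ (a, c) = 1 \<and> H $$ (b, c) = 1 \<and> H $$ (b, d) = 1 \<and> H $$ (a, d) = 1)"
    (is "_ \<longleftrightarrow> ?R")
proof -
  have less4: "(\<forall>l<4. P l) \<longleftrightarrow> P 0 \<and> P 1 \<and> P 2 \<and> P 3" for P :: "nat \<Rightarrow> bool"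
    by (auto simp: eval_nat_numeral less_Suc_eq)
  have set4: "{..<4} = {0, 1, 2, 3::nat}" by auto
  show ?thesis
  proof
    assume "has_cycle H 4"
    then obtain k x y where "4 = 2 * k"
      and "\<forall>l<2 * k. cycle_position k x y l \<in> {..<dim_row H} \<times> {..<dim_col H} \<and>
             H $$ cycle_position k x y l = 1"
      and "inj_on (cycle_position k x y) {..<2 * k}"
      unfolding has_cycle_def by blast
    moreover from this(1) have "k = 2" by simp
    ultimately
      have pos: "\<forall>l<4. cycle_position 2 x y l \<in> {..<dim_row H} \<times> {..<dim_col H} \<and>
                     H $$ cycle_position 2 x y l = 1"
        and inj: "inj_on (cycle_position 2 x y) {..<4}"
      by simp_all
    show ?R
      using pos inj unfolding less4 set4
      by (intro exI[of _ "x 0"] exI[of _ "x 1"] exI[of _ "y 0"] exI[of _ "y 1"])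
         (auto simp: cycle_position_def inj_on_def)
  next
    assume ?R
    then obtain a b c d where *: "a < dim_row H" "b < dim_row H" "c < dim_col H" "d < dim_col H"
      "a \<noteq> b" "c \<noteq> d" "H $$ (a, c) = 1" "H $$ (b, c) = 1" "H $$ (b, d) = 1" "H $$ (a, d) = 1"
      by blast
    let ?x = "\<lambda>l::nat. if l = 0 then a else b" and ?y = "\<lambda>l::nat. if l = 0 then c else d"
    have "\<forall>l<4. cycle_position 2 ?x ?y l \<in> {..<dim_row H} \<times> {..<dim_col H} \<and>
            H $$ cycle_position 2 ?x ?y l = 1"
      using * unfolding less4 by (simp add: cycle_position_def)
    moreover have "inj_on (cycle_position 2 ?x ?y) {..<4}"
      using * unfolding set4 by (auto simp: cycle_position_def inj_on_def)
    ultimately show "has_cycle H 4"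
      unfolding has_cycle_def
      by (intro exI[of _ 2] exI[of _ ?x] exI[of _ ?y]) simp
  qed
qed

lemma index_perm_block_matrix_eq_1_iff:
  assumes "n > 0" "x < b * n" "y < d * n"
  shows "(perm_block_matrix n b d P :: 'a::zero_neq_one mat) $$ (x, y) = 1 \<longleftrightarrow>
           x mod n = P (x div n) (y div n) (y mod n)"
  using assms by (simp add: perm_block_matrix_def perm_matrix_def)

text \<open>Here \<open>k\<close> and \<open>l\<close> are the block columns of the cycle's two
  columns, and \<open>c\<close> is their common offset. Powers of \<open>f\<close> enter only
  later.\<close>

lemma has_cycle_4_two_block_rows_iff:
  assumes "n > 0"
    and perm: "\<And>l. l < d \<Longrightarrow> P 1 l permutes {..<n}"
    and id: "\<And>l. l < d \<Longrightarrow> P 0 l = id"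
  shows "has_cycle (perm_block_matrix n 2 d P :: 'a::zero_neq_one mat) 4 \<longleftrightarrow>
           (\<exists>c<n. \<exists>k<d. \<exists>l<d. k \<noteq> l \<and> P 1 k c = P 1 l c)"
    (is "has_cycle ?H 4 \<longleftrightarrow> ?R")
proof -
  have dim: "dim_row ?H = 2 * n" "dim_col ?H = d * n"
    by (simp_all add: perm_block_matrix_def)
  note one = index_perm_block_matrix_eq_1_iff[OF \<open>n > 0\<close>]
  show ?thesis
  proof
    \<comment> \<open>The case of row \<open>x\<close> in the upper and \<open>x'\<close> in the
      lower block row; the other order follows by exchanging the rows.\<close>
    have coincidence: ?R
      if "x < n" "n \<le> x'" "x' < 2 * n" "y < d * n" "y' < d * n" "y \<noteq> y'"
        "?H $$ (x, y) = 1" "?H $$ (x', y) = 1" "?H $$ (x', y') = 1" "?H $$ (x, y') = 1"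
      for x x' y y'
    proof -
      have d: "y div n < d" "y' div n < d"
        using that by (simp_all add: less_mult_imp_div_less)
      have "x' div n = 1"
        using that by (intro div_nat_eqI) auto
      \<comment> \<open>Both offsets equal \<open>x\<close> because the upper blocks are identities;
        both values of \<open>P 1\<close> equal \<open>x' mod n\<close>.\<close>
      then have "y mod n = y' mod n" "P 1 (y div n) (y mod n) = P 1 (y' div n) (y' mod n)"
        using that d by (simp_all add: one id)
      moreover from this(1) have "y div n \<noteq> y' div n"
        using \<open>y \<noteq> y'\<close> by (metis div_mult_mod_eq)
      ultimately show ?R
        using d \<open>n > 0\<close> by (metis mod_less_divisor)
    qed
    assume "has_cycle ?H 4"
    then obtain x x' y y' where *: "x < 2 * n" "x' < 2 * n" "y < d * n" "y' < d * n"
      "x \<noteq> x'" "y \<noteq> y'" "?H $$ (x, y) = 1" "?H $$ (x', y) = 1"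
      "?H $$ (x', y') = 1" "?H $$ (x, y') = 1"
      unfolding has_cycle_4_iff dim by blast
    \<comment> \<open>Within one block, the column determines the row of its entry 1.\<close>
    have "x div n \<noteq> x' div n"
    proof
      assume "x div n = x' div n"
      moreover from this * have "x mod n = x' mod n" by (simp add: one)
      ultimately show False using \<open>x \<noteq> x'\<close> by (metis div_mult_mod_eq)
    qed
    moreover have "u div n = (if u < n then 0 else 1)" if "u < 2 * n" for u
      using that by (auto intro!: div_nat_eqI)
    ultimately consider "x < n" "n \<le> x'" | "x' < n" "n \<le> x"
      using * by (metis not_less)
    then show ?R
      using coincidence[of x x' y y'] coincidence[of x' x y y'] * by cases auto
  next
    assume ?R
    then obtain c k l where *: "c < n" "k < d" "l < d" "k \<noteq> l" "P 1 k c = P 1 l c"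
      by blast
    \<comment> \<open>Row \<open>c\<close> meets the identity blocks at offset \<open>c\<close>;
      \<open>?x'\<close> is the lower row holding the entry 1 of column \<open>?col k\<close> and,
      by the coincidence, also of \<open>?col l\<close>.\<close>
    let ?x' = "n + P 1 k c" and ?col = "\<lambda>k. k * n + c"
    have less: "P 1 k c < n"
      using permutes_in_image[OF perm[OF \<open>k < d\<close>], of c] \<open>c < n\<close> by simp
    have col: "?col j < d * n" "?col j div n = j" "?col j mod n = c" if "j < d" for j
    proof -
      have "?col j < Suc j * n" using \<open>c < n\<close> by simp
      also have "\<dots> \<le> d * n" using that by (intro mult_le_mono1) simp
      finally show "?col j < d * n" .
    qed (use \<open>c < n\<close> in auto)
    have x': "?x' div n = 1" "?x' mod n = P 1 k c" "?x' < 2 * n"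
      using less by (auto intro!: div_nat_eqI)
    have "?col k \<noteq> ?col l" using \<open>k \<noteq> l\<close> \<open>n > 0\<close> by simp
    moreover have "?H $$ (c, ?col k) = 1" "?H $$ (c, ?col l) = 1"
      "?H $$ (?x', ?col k) = 1" "?H $$ (?x', ?col l) = 1"
      using * x' col[OF \<open>k < d\<close>] col[OF \<open>l < d\<close>]
      by (simp_all add: one id del: mod_add_self1)
    ultimately show "has_cycle ?H 4"
      unfolding has_cycle_4_iff dim
      using * x'(3) col(1)
      by (intro exI[of _ c] exI[of _ ?x'] exI[of _ "?col k"] exI[of _ "?col l"] conjI) auto
  qed
qed

theorem theorem5:
  fixes n m r :: nat and f :: "nat \<Rightarrow> nat" and i :: "nat \<Rightarrow> int" and I :: "int set"
    and H :: "'a::zero_neq_one mat"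
  assumes "n > 0"
    and "f permutes {..<n}"
    and "m = group.ord (symmetric_group {..<n}) f"
    and "r > 1"
    and "\<forall>j\<in>{1..r}. i j \<in> {0..<int m} \<and> i j \<noteq> 0"
    and "inj_on i {1..r}"
    and "I = {0} \<union> i ` {1..r}"
    and "H = parity_check_matrix n r f i"
  shows "\<not> has_cycle H 4 \<longleftrightarrow> (\<forall>t\<in>difference_set m I. derangement n (f ^^ nat t))"
proof -
  \<comment> \<open>The value \<open>i 0\<close> is unconstrained; \<open>e\<close> puts exponent 0
    there, so that all block columns are treated alike.\<close>
  define e where "e l = (if l = 0 then 0 else i l)" for l
  \<comment> \<open>Since \<open>r > 1\<close>, index 1 is available, and its exponent shows that
    the residue range is nonempty.\<close>
  have "i 1 \<in> {0..<int m}" using assms(4,5) by force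
  then have "m > 0" by auto
  have fm: "f ^^ m = id"
    using funpow_ord_symmetric_group[OF assms(2)] assms(3) by simp
  have pos: "0 < e l" if "l \<le> r" "l \<noteq> 0" for l
  proof -
    have "i l \<in> {0..<int m} \<and> i l \<noteq> 0" using that assms(5) by simp
    then show ?thesis using that by (simp add: e_def)
  qed
  then have e_nonneg: "0 \<le> e l" if "l \<le> r" for l
    using that by (cases "l = 0") (simp_all add: e_def order_less_imp_le)
  \<comment> \<open>Makes distinct block columns the same as distinct exponents; the case of block
    column 0 uses that the \<open>i l\<close> are nonzero.\<close>
  have e_inj: "e k \<noteq> e l" if "k \<le> r" "l \<le> r" "k \<noteq> l" for k l
  proof (cases "k = 0 \<or> l = 0")
    case True
    then show ?thesis using pos[of k] pos[of l] that by (auto simp: e_def)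
  next
    case False
    then show ?thesis using that inj_onD[OF assms(6), of k l] by (auto simp: e_def)
  qed
  have "{..r} = insert 0 {1..r}" by auto
  then have I: "I = e ` {..r}"
    unfolding assms(7) by (auto simp: e_def)
  have perm: "f ^^ k permutes {..<n}" for k
    by (rule permutes_funpow[OF assms(2)])
  have "has_cycle H 4 \<longleftrightarrow>
      (\<exists>c<n. \<exists>k<r + 1. \<exists>l<r + 1. k \<noteq> l \<and> (f ^^ nat (e k)) c = (f ^^ nat (e l)) c)"
  proof -
    \<comment> \<open>The lower left identity block is absorbed as
      \<open>f ^^ nat (e 0)\<close>.\<close>
    have "H = perm_block_matrix n 2 (r + 1) (\<lambda>u l. if u = 0 then id else f ^^ nat (e l))"
      unfolding assms(8) parity_check_matrix_def
      by (intro arg_cong[where f = "perm_block_matrix n 2 (r + 1)"]) (auto simp: e_def fun_eq_iff)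
    then show ?thesis
      by (simp add: has_cycle_4_two_block_rows_iff[OF assms(1)] perm)
  qed
  also have "\<dots> \<longleftrightarrow>
      (\<exists>c<n. \<exists>k<r + 1. \<exists>l<r + 1. k \<noteq> l \<and> (f ^^ nat ((e k - e l) mod int m)) c = c)"
  proof -
    have "(f ^^ nat (e k)) c = (f ^^ nat (e l)) c \<longleftrightarrow>
        (f ^^ nat ((e k - e l) mod int m)) c = c" if "k < r + 1" "l < r + 1" for c k l
      using funpow_eq_iff_fixpoint[OF permutes_inj[OF assms(2)] fm \<open>m > 0\<close>,
          of "nat (e k)" c "nat (e l)"]
        e_nonneg[of k] e_nonneg[of l] that by simp
    then show ?thesis by blast
  qed
  also have "\<dots> \<longleftrightarrow> (\<exists>t\<in>difference_set m I. \<exists>c<n. (f ^^ nat t) c = c)"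
  proof -
    \<comment> \<open>Reindexes the differences from pairs of exponents to pairs of block
      columns.\<close>
    have "difference_set m I = {(e k - e l) mod int m | k l. k < r + 1 \<and> l < r + 1 \<and> k \<noteq> l}"
    proof (intro equalityI subsetI)
      fix t assume "t \<in> difference_set m I"
      then obtain k l where "t = (e k - e l) mod int m" "k \<le> r" "l \<le> r" "e k \<noteq> e l"
        unfolding I difference_set_def by (elim CollectE exE conjE imageE) simp
      moreover from this have "k \<noteq> l" by metis
      ultimately show "t \<in> {(e k - e l) mod int m | k l. k < r + 1 \<and> l < r + 1 \<and> k \<noteq> l}"
        by (intro CollectI exI[of _ k] exI[of _ l]) simp
    next
      fix t assume "t \<in> {(e k - e l) mod int m | k l. k < r + 1 \<and> l < r + 1 \<and> k \<noteq> l}"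
      then obtain k l where "t = (e k - e l) mod int m" "k \<le> r" "l \<le> r" "k \<noteq> l" by auto
      then show "t \<in> difference_set m I"
        unfolding I difference_set_def using e_inj[of k l]
        by (intro CollectI exI[of _ "e k"] exI[of _ "e l"]) simp
    qed
    then show ?thesis
      by (simp only:) blast
  qed
  \<comment> \<open>Each power of \<open>f\<close> permutes \<open>{..<n}\<close>, so it fails to be
    a derangement only through a fixed point below \<open>n\<close>.\<close>
  finally show ?thesis
    by (auto simp: derangement_def perm)
qed

end
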